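(* For every nonempty compact metrizable space $Z$ there is a Peano graph $X$ with ground space $\operatorname{Gr}(X)=Z$ (as a subspace). Moreover, for any $x,y\in Z$, $X$ can be chosen so that (1) $X$ is Eulerian, or alternatively so that (2) $X$ is open Eulerian from $x$ to $y$, i.e. there is a strongly irreducible continuous surjection $g:[0,1]\to X$ with $g(0)=x$ and $g(1)=y$.
   Context: A Peano continuum is a compact connected locally connected metrizable space; a free arc (edge) is an inclusion-maximal open subset homeomorphic to $(0,1)$; $\operatorname{Gr}(X)$ is $X$ minus the union of all edges; a Peano graph is a Peano continuum in which the union of edges is dense. A continuous surjection $g:K\to X$ ($K=S^1$ or $[0,1]$) is strongly irreducible if $g(A)\neq X$ for every closed $A\subsetneq K$; $X$ is Eulerian if there is such a map with $K=S^1$. *)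

theory Defs
  imports "HOL-Analysis.Analysis"
begin

definition peano_continuum :: "'a topology \<Rightarrow> bool" where
  "peano_continuum X \<longleftrightarrow> topspace X \<noteq> {} \<and> compact_space X \<and> connected_space X
     \<and> locally_connected_space X \<and> metrizable_space X"

definition open_arc_set :: "'a topology \<Rightarrow> 'a set \<Rightarrow> bool" where
  "open_arc_set X E \<longleftrightarrow> openin X E \<and>
     (subtopology X E) homeomorphic_space (top_of_set {0<..<(1::real)})"

definition free_arc :: "'a topology \<Rightarrow> 'a set \<Rightarrow> bool" where
  "free_arc X E \<longleftrightarrow> open_arc_set X E \<and>
     (\<forall>E'. open_arc_set X E' \<and> E \<subseteq> E' \<longrightarrow> E' = E)"

definition Gr :: "'a topology \<Rightarrow> 'a set" where
  "Gr X = topspace X - \<Union>{E. free_arc X E}"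

definition peano_graph :: "'a topology \<Rightarrow> bool" where
  "peano_graph X \<longleftrightarrow> peano_continuum X \<and>
     X closure_of (\<Union>{E. free_arc X E}) = topspace X"

definition strongly_irreducible :: "'k topology \<Rightarrow> 'a topology \<Rightarrow> ('k \<Rightarrow> 'a) \<Rightarrow> bool" where
  "strongly_irreducible K X g \<longleftrightarrow> continuous_map K X g \<and> g ` topspace K = topspace X \<and>
     (\<forall>A. closedin K A \<and> A \<subset> topspace K \<longrightarrow> g ` A \<noteq> topspace X)"

definition eulerian :: "'a topology \<Rightarrow> bool" where
  "eulerian X \<longleftrightarrow> (\<exists>g. strongly_irreducible (top_of_set (sphere (0::complex) 1)) X g)"

definition open_eulerian :: "'a topology \<Rightarrow> 'a \<Rightarrow> 'a \<Rightarrow> bool" where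
  "open_eulerian X x y \<longleftrightarrow>
     (\<exists>g. strongly_irreducible (top_of_set {0..(1::real)}) X g \<and> g 0 = x \<and> g 1 = y)"

end

theory Submission
  imports Defs
begin

text \<open>A closed nowhere dense set \<open>D \<subseteq> [0,1]\<close> containing both endpoints is mapped continuously onto \<open>Z\<close>
  by some \<open>f\<close>, and \<open>X\<close> is the adjunction space \<open>Z \<union>\<^sub>f [0,1]\<close>.  The quotient map \<open>g\<close> from \<open>[0,1]\<close> is
  injective on the dense set of gaps of \<open>D\<close>, hence strongly irreducible, and it runs from \<open>f 0\<close> to
  \<open>f 1\<close>; taking \<open>f 0 = f 1\<close> gives the Eulerian case.  The gaps become open arcs.  To ensure that no
  larger open arc exists, \<open>D\<close> and \<open>f\<close> are chosen such that arbitrarily close to each point of \<open>Z\<close>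
  there is a gap whose two ends have the same image: this gives a loop, which no open arc contains.\<close>

subsection \<open>Quotients of the unit interval\<close>

lemma ex_notin_if_interior_empty:
  fixes S :: "real set"
  assumes "interior S = {}" "a < b"
  shows "\<exists>t\<in>{a<..<b}. t \<notin> S"
proof (rule ccontr)
  assume "\<not> ?thesis"
  then have "{a<..<b} \<subseteq> interior S"
    by (intro interior_maximal) auto
  with assms dense[of a b] show False
    by auto
qed

lemma interior_emptyI:
  fixes S :: "real set"
  assumes "\<And>a b. a < b \<Longrightarrow> \<exists>t\<in>{a<..<b}. t \<notin> S"
  shows "interior S = {}"
proof (rule ccontr)
  assume "interior S \<noteq> {}"
  then obtain u e where "e > 0" "ball u e \<subseteq> S"
    using mem_interior by blast
  with assms[of "u - e" "u + e"] show False
    by (auto simp: ball_eq_greaterThanLessThan)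
qed

lemma open_arc_interval:
  fixes a b :: real
  assumes "a < b"
  shows "top_of_set {a<..<b} homeomorphic_space top_of_set {0<..<1::real}"
proof -
  have "a + s * (b - a) < b" if "s < 1" for s
    using assms mult_strict_right_mono[OF that, of "b - a"] by (simp add: less_diff_eq)
  moreover have "continuous_on {a<..<b} (\<lambda>t. (t - a) / (b - a))" "continuous_on {0<..<1} (\<lambda>s. a + s * (b - a))"
    using assms by (auto intro!: continuous_intros)
  ultimately have "homeomorphic_maps (top_of_set {a<..<b}) (top_of_set {0<..<1})
      (\<lambda>t. (t - a) / (b - a)) (\<lambda>s. a + s * (b - a))"
    using assms unfolding homeomorphic_maps_def
    by (auto simp: continuous_map_in_subtopology divide_simps)
  then show ?thesis
    using homeomorphic_space_def by blast
qed

text \<open>An abstract form of the quotient map onto the adjunction space. By \<open>inj\<close>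
  all gluing takes place inside \<open>D\<close>. By \<open>loops\<close> every neighbourhood of a
  ground point contains a closed-up gap, though this loop need not pass through the point
  itself.\<close>

locale arc_quotient =
  fixes X :: "'b topology" and g :: "real \<Rightarrow> 'b" and D :: "real set"
  assumes Hausdorff: "Hausdorff_space X"
    and cont: "continuous_map (top_of_set {0..1}) X g"
    and surj: "g ` {0..1} = topspace X"
    and closed_D: "closed D" and D_sub: "D \<subseteq> {0..1}" and zero_D: "0 \<in> D" and one_D: "1 \<in> D"
    and interior_D: "interior D = {}"
    and inj: "\<And>s t. \<lbrakk>s \<in> {0..1} - D; t \<in> {0..1}; g s = g t\<rbrakk> \<Longrightarrow> s = t"
    and loops: "\<And>U z. \<lbrakk>openin X U; z \<in> U; z \<in> g ` D\<rbrakk> \<Longrightarrow>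
       \<exists>p q. p < q \<and> p \<in> D \<and> q \<in> D \<and> {p<..<q} \<inter> D = {} \<and> g p = g q \<and> g ` {p..q} \<subseteq> U"
begin

lemma closedin_image:
  assumes "closed S" "S \<subseteq> {0..1}"
  shows "closedin X (g ` S)"
proof -
  have "compact S"
    using assms by (meson bounded_subset bounded_closed_interval compact_eq_bounded_closed)
  then have "compactin (top_of_set {0..1}) S"
    using assms by (simp add: compactin_subtopology)
  then show ?thesis
    by (intro compactin_imp_closedin[OF Hausdorff] image_compactin[OF _ cont])
qed

text \<open>Since \<open>S\<close> avoids \<open>D\<close>, it is saturated for \<open>g\<close>; so
  the complement of its image is the image of a compact set.\<close>

lemma openin_image:
  assumes "open S" "S \<subseteq> {0..1} - D"
  shows "openin X (g ` S)"
proof -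
  have "g s \<noteq> g t" if "s \<in> S" "t \<in> {0..1} - S" for s t
    using inj[of s t] assms(2) that by blast
  then have "g ` S \<inter> g ` ({0..1} - S) = {}"
    by blast
  moreover have "g ` {0..1} = g ` S \<union> g ` ({0..1} - S)"
    using assms(2) by blast
  ultimately have "topspace X - g ` S = g ` ({0..1} - S)"
    unfolding surj[symmetric] by blast
  moreover have "closedin X (g ` ({0..1} - S))"
    using assms by (intro closedin_image) auto
  moreover have "g ` S \<subseteq> topspace X"
    using assms surj by auto
  ultimately show ?thesis
    by (simp add: openin_closedin_eq)
qed

lemma homeomorphic_map_edges:
  assumes "open U" "U \<subseteq> {0..1} - D"
  shows "homeomorphic_map (top_of_set U) (subtopology X (g ` U)) g"
proof (rule bijective_open_imp_homeomorphic_map)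
  have "continuous_map (top_of_set U) X g"
    by (rule continuous_map_from_subtopology_mono[OF cont]) (use assms(2) in blast)
  then show "continuous_map (top_of_set U) (subtopology X (g ` U)) g"
    by (simp add: continuous_map_into_subtopology)
  show "open_map (top_of_set U) (subtopology X (g ` U)) g"
    unfolding open_map_def
  proof (intro allI impI)
    fix S assume "openin (top_of_set U) S"
    then have "open S" "S \<subseteq> U"
      using assms(1) openin_open_eq by auto
    then have "openin X (g ` S)"
      using assms(2) by (intro openin_image) auto
    with \<open>S \<subseteq> U\<close> show "openin (subtopology X (g ` U)) (g ` S)"
      using openin_image[OF assms] by (simp add: openin_open_subtopology image_mono)
  qed
  show "g ` topspace (top_of_set U) = topspace (subtopology X (g ` U))"
    using assms(2) surj by auto
  show "inj_on g (topspace (top_of_set U))"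
  proof (rule inj_onI)
    fix s t assume "s \<in> topspace (top_of_set U)" "t \<in> topspace (top_of_set U)" "g s = g t"
    with assms(2) show "s = t"
      by (intro inj) auto
  qed
qed

lemma complement_eq: "{0..1} - D = {0<..<1} - D"
  using zero_D one_D by (auto simp: less_le)

lemma open_complement: "open ({0..1} - D)"
  unfolding complement_eq using closed_D by (simp add: open_Diff)

lemma open_arc_gap:
  assumes "a < b" "{a<..<b} \<subseteq> {0..1} - D"
  shows "open_arc_set X (g ` {a<..<b})"
proof -
  have "top_of_set {a<..<b} homeomorphic_space subtopology X (g ` {a<..<b})"
    using homeomorphic_map_imp_homeomorphic_space[OF homeomorphic_map_edges[OF _ assms(2)]] by simp
  then have "subtopology X (g ` {a<..<b}) homeomorphic_space top_of_set {0<..<1::real}"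
    using open_arc_interval[OF assms(1)] homeomorphic_space_trans homeomorphic_space_sym by metis
  then show ?thesis
    unfolding open_arc_set_def using openin_image[OF _ assms(2)] by simp
qed

text \<open>The ends are the last point of \<open>D\<close> before \<open>t\<close> and the first
  one after it; they exist because \<open>0\<close> and \<open>1\<close> lie in
  \<open>D\<close>.\<close>

lemma ex_gap:
  assumes "t \<in> {0..1} - D"
  obtains a b where "a \<in> D" "b \<in> D" "a < t" "t < b" "{a<..<b} \<inter> D = {}"
proof -
  have "compact (D \<inter> {0..t})" "compact (D \<inter> {t..1})"
    using closed_D by (auto intro: closed_Int_compact)
  moreover have "0 \<in> D \<inter> {0..t}" "1 \<in> D \<inter> {t..1}"
    using assms zero_D one_D by auto
  ultimately obtain a b where a: "a \<in> D \<inter> {0..t}" "\<And>s. s \<in> D \<inter> {0..t} \<Longrightarrow> s \<le> a"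
    and b: "b \<in> D \<inter> {t..1}" "\<And>s. s \<in> D \<inter> {t..1} \<Longrightarrow> b \<le> s"
    using compact_attains_sup[of "D \<inter> {0..t}"] compact_attains_inf[of "D \<inter> {t..1}"] by blast
  have "s \<notin> D" if "a < s" "s < b" for s
  proof
    assume "s \<in> D"
    then show False
      using a(2)[of s] b(2)[of s] that D_sub by (cases "s \<le> t") auto
  qed
  moreover have "a \<noteq> t" "b \<noteq> t"
    using a b assms by auto
  ultimately show ?thesis
    using a b by (intro that[of a b]) (auto simp: less_le)
qed

text \<open>An open arc around a ground point would contain a whole loop, and no loop
  can be mapped injectively to the line.\<close>
lemma open_arc_avoids_ground:
  assumes "open_arc_set X E"
  shows "E \<inter> g ` D = {}"
proof (rule ccontr)
  assume "E \<inter> g ` D \<noteq> {}"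
  then obtain z where "z \<in> E" "z \<in> g ` D"
    by blast
  then obtain p q where pq: "p < q" "p \<in> D" "q \<in> D" "{p<..<q} \<inter> D = {}" "g p = g q" "g ` {p..q} \<subseteq> E"
    using loops[of E z] assms unfolding open_arc_set_def by metis
  obtain \<phi> where \<phi>: "homeomorphic_map (subtopology X E) (top_of_set {0<..<1::real}) \<phi>"
    using assms unfolding open_arc_set_def homeomorphic_space by blast
  have pq01: "{p..q} \<subseteq> {0..1}"
    using pq D_sub by auto
  define k where "k = \<phi> \<circ> g"
  have "continuous_map (top_of_set {p..q}) X g"
    by (rule continuous_map_from_subtopology_mono[OF cont pq01])
  then have "continuous_map (top_of_set {p..q}) (subtopology X E) g"
    using pq(6) by (simp add: continuous_map_into_subtopology image_subset_iff_funcset)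
  then have "continuous_map (top_of_set {p..q}) (top_of_set {0<..<1}) k"
    unfolding k_def using \<phi> continuous_map_compose homeomorphic_imp_continuous_map by blast
  then have contk: "continuous_on {p..q} k"
    using continuous_map_in_subtopology by fastforce
  have injk: "g s = g t" if "s \<in> {p..q}" "t \<in> {p..q}" "k s = k t" for s t
  proof -
    have "inj_on \<phi> E"
      using homeomorphic_imp_injective_map[OF \<phi>] assms
      unfolding open_arc_set_def by (simp add: openin_subset inf_absorb2)
    then show ?thesis
      using that pq(6) inj_onD[of \<phi> E "g s" "g t"] unfolding k_def comp_def by blast
  qed
  \<comment> \<open>Only one of the two parameters has to lie off \<open>D\<close>, so the other may
    be an end of the gap.\<close>
  have injg: "s = t" if "s \<in> {p<..<q}" "t \<in> {p..q}" "k s = k t" for s t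
    using inj[of s t] injk[of s t] that pq(4) pq01 by (auto simp: subset_iff disjoint_iff)
  define m where "m = (p + q) / 2"
  have m: "p < m" "m < q"
    using pq(1) by (auto simp: m_def)
  have kpq: "k p = k q"
    using pq(5) by (simp add: k_def)
  have "k m \<noteq> k p"
    using injg[of m p] m by auto
  \<comment> \<open>As \<open>k p = k q\<close>, a value strictly between \<open>k m\<close> and
    \<open>k p\<close> is attained on both sides of \<open>m\<close>. By \<open>injg\<close> the two
    parameters coincide, hence equal \<open>m\<close>, where the value is a different one.\<close>
  then obtain y where y: "k m < y \<and> y < k p \<or> k p < y \<and> y < k m"
    by (meson dense linorder_neqE)
  have c1: "continuous_on {p..m} k" and c2: "continuous_on {m..q} k"
    using contk m by (auto elim: continuous_on_subset)
  have "\<exists>s. p \<le> s \<and> s \<le> m \<and> k s = y"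
    using y m IVT'[OF _ _ _ c1, of y] IVT2'[OF _ _ _ c1, of y] by fastforce
  moreover have "\<exists>t. m \<le> t \<and> t \<le> q \<and> k t = y"
    using y m kpq IVT'[OF _ _ _ c2, of y] IVT2'[OF _ _ _ c2, of y] by fastforce
  ultimately obtain s t where st: "p \<le> s" "s \<le> m" "k s = y" "m \<le> t" "t \<le> q" "k t = y"
    by blast
  have "s \<noteq> p" "s \<noteq> m" "s \<noteq> q" "t \<noteq> m"
    using y st kpq by auto
  with st m injg[of s t] show False
    by auto
qed

text \<open>A larger open arc avoids the ground points, so it comes from a set \<open>V\<close> of
  parameters off \<open>D\<close>. There \<open>g\<close> is a homeomorphism onto its image, so
  \<open>V\<close> is connected; it meets the gap but misses both ends, and therefore stays
  inside.\<close>

lemma free_arc_gap: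
  assumes "a \<in> D" "b \<in> D" "a < b" "{a<..<b} \<inter> D = {}"
  shows "free_arc X (g ` {a<..<b})"
proof -
  have ab: "{a<..<b} \<subseteq> {0..1} - D"
    using assms D_sub by (auto simp: subset_iff disjoint_iff)
  have "E = g ` {a<..<b}" if E: "open_arc_set X E" "g ` {a<..<b} \<subseteq> E" for E
  proof -
    define V where "V = {t \<in> {0..1} - D. g t \<in> E}"
    have EX: "E \<subseteq> topspace X"
      using E(1) unfolding open_arc_set_def by (simp add: openin_subset)
    have EV: "E = g ` V"
      using EX open_arc_avoids_ground[OF E(1)] unfolding V_def surj[symmetric] by blast
    have "connected_space (top_of_set {0<..<1::real})"
      by (simp add: connected_space_subtopology)
    then have "connected_space (subtopology X E)"
      using E(1) homeomorphic_connected_space unfolding open_arc_set_def by metis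
    then have "connectedin X (g ` V)"
      using EX EV by (simp add: connectedin_def)
    then have "connectedin (subtopology X (g ` ({0..1} - D))) (g ` V)"
      using connectedin_subtopology unfolding V_def by blast
    moreover have "V \<subseteq> topspace (top_of_set ({0..1} - D))"
      unfolding V_def by auto
    ultimately have "connectedin (top_of_set ({0..1} - D)) V"
      using homeomorphic_map_connectedness[OF homeomorphic_map_edges[OF open_complement order_refl]]
      by blast
    then have V: "connected V"
      by (simp add: connectedin_subtopology)
    define m where "m = (a + b) / 2"
    have m: "a < m" "m < b"
      using assms(3) by (auto simp: m_def)
    then have "m \<in> V"
      using ab E(2) unfolding V_def by fastforce
    have "v \<in> {a<..<b}" if "v \<in> V" for v
    proof (rule ccontr)
      assume "v \<notin> {a<..<b}"
      then have "a \<in> V \<or> b \<in> V"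
        using connectedD_interval[OF V \<open>m \<in> V\<close> that, of b] connectedD_interval[OF V that \<open>m \<in> V\<close>, of a] m
        by (auto simp: not_less)
      then show False
        using assms by (auto simp: V_def)
    qed
    then have "V \<subseteq> {a<..<b}"
      by blast
    with EV E(2) show ?thesis
      by blast
  qed
  then show ?thesis
    unfolding free_arc_def using open_arc_gap[OF assms(3) ab] by blast
qed

lemma Union_free_arcs: "\<Union>{E. free_arc X E} = g ` ({0..1} - D)"
proof (intro equalityI subsetI)
  fix z assume "z \<in> \<Union>{E. free_arc X E}"
  then obtain E where E: "open_arc_set X E" "z \<in> E"
    unfolding free_arc_def by blast
  then have "z \<in> g ` {0..1}"
    unfolding surj open_arc_set_def using openin_subset by blast
  with open_arc_avoids_ground[OF E(1)] E(2) show "z \<in> g ` ({0..1} - D)"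
    by blast
next
  fix z assume "z \<in> g ` ({0..1} - D)"
  then obtain t where t: "t \<in> {0..1} - D" "z = g t"
    by blast
  then obtain a b where "a \<in> D" "b \<in> D" "a < t" "t < b" "{a<..<b} \<inter> D = {}"
    using ex_gap by metis
  then have "free_arc X (g ` {a<..<b})" "z \<in> g ` {a<..<b}"
    using free_arc_gap t by auto
  then show "z \<in> \<Union>{E. free_arc X E}"
    by blast
qed

lemma Gr_eq: "Gr X = g ` D"
proof -
  have "g s \<noteq> g t" if "s \<in> D" "t \<in> {0..1} - D" for s t
    using inj[of t s] D_sub that by force
  then have "g ` D \<inter> g ` ({0..1} - D) = {}"
    by blast
  moreover have "g ` {0..1} = g ` D \<union> g ` ({0..1} - D)"
    using D_sub by blast
  ultimately show ?thesis
    unfolding Gr_def Union_free_arcs surj[symmetric] by blast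
qed

section \<open>Strong irreducibility and the Peano graph axioms\<close>

lemma ex_edge_point:
  assumes "openin (top_of_set {0..1}) U" "U \<noteq> {}"
  obtains t where "t \<in> U" "t \<in> {0..1} - D"
proof -
  obtain V where V: "open V" "U = {0..1} \<inter> V"
    using assms(1) by (meson openin_open)
  obtain u where u: "u \<in> {0..1}" "u \<in> V"
    using assms(2) V by blast
  then obtain e where e: "e > 0" "ball u e \<subseteq> V"
    using V(1) open_contains_ball by blast
  \<comment> \<open>Clipping to the unit interval leaves a nondegenerate interval even if
    \<open>u\<close> is \<open>0\<close> or \<open>1\<close>.\<close>
  have "max 0 (u - e) < min 1 (u + e)"
    using u e by auto
  then obtain t where "max 0 (u - e) < t" "t < min 1 (u + e)" "t \<notin> D"
    using ex_notin_if_interior_empty[OF interior_D, of "max 0 (u - e)" "min 1 (u + e)"] by auto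
  moreover from this have "t \<in> ball u e"
    by (auto simp: dist_real_def)
  ultimately show ?thesis
    using e(2) V(2) that[of t] by auto
qed

text \<open>The complement of a proper closed set contains a parameter off \<open>D\<close>. Its
  image has no other preimage, so the closed set does not reach it.\<close>

lemma strongly_irreducible: "strongly_irreducible (top_of_set {0..1}) X g"
  unfolding strongly_irreducible_def
proof (intro conjI allI impI)
  fix A assume A: "closedin (top_of_set {0..1}) A \<and> A \<subset> topspace (top_of_set {0..1::real})"
  then have "openin (top_of_set {0..1}) ({0..1} - A)" "{0..1} - A \<noteq> {}"
    by (auto simp: openin_diff)
  then obtain t where t: "t \<in> {0..1} - A" "t \<in> {0..1} - D"
    by (rule ex_edge_point)
  moreover have "A \<subseteq> {0..1}"
    using A by auto
  ultimately have "g t \<notin> g ` A"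
    using inj[of t] by blast
  moreover have "g t \<in> topspace X"
    using t surj by blast
  ultimately show "g ` A \<noteq> topspace X"
    by blast
qed (simp_all add: cont surj)

lemma open_eulerian: "open_eulerian X (g 0) (g 1)"
  unfolding open_eulerian_def using strongly_irreducible by blast

text \<open>Compactness and connectedness pass to continuous images. Local connectedness passes to
  quotients, and \<open>g\<close> is a quotient map because it is closed. Edges are dense because
  the complement of \<open>D\<close> is.\<close>

lemma peano_graph:
  assumes "metrizable_space X"
  shows "peano_graph X"
proof -
  have compact: "compact_space X"
    using image_compactin[OF _ cont, of "{0..1}"] surj
    by (simp add: compact_space_def compactin_subtopology)
  have connected: "connected_space X"
    using connectedin_continuous_map_image[OF cont, of "{0..1}"] surj
    by (simp add: connectedin_subtopology connectedin_topspace)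
  have "closed_map (top_of_set {0..1}) X g"
    using cont Hausdorff by (simp add: compact_space_subtopology continuous_imp_closed_map)
  then have "quotient_map (top_of_set {0..1}) X g"
    using cont surj by (simp add: continuous_closed_imp_quotient_map)
  then have lc: "locally_connected_space X"
    using locally_connected_space_quotient_map_image locally_connected_real_interval by blast
  have "topspace X \<subseteq> X closure_of (g ` ({0..1} - D))"
  proof
    fix z assume z: "z \<in> topspace X"
    show "z \<in> X closure_of (g ` ({0..1} - D))"
      unfolding in_closure_of
    proof (intro conjI z allI impI)
      fix T assume T: "z \<in> T \<and> openin X T"
      have "openin (top_of_set {0..1}) {t \<in> {0..1}. g t \<in> T}"
        using openin_continuous_map_preimage[OF cont, of T] T by simp
      moreover have "{t \<in> {0..1}. g t \<in> T} \<noteq> {}"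
        using z T unfolding surj[symmetric] by blast
      ultimately obtain t where "t \<in> {t \<in> {0..1}. g t \<in> T}" "t \<in> {0..1} - D"
        by (rule ex_edge_point)
      then show "\<exists>y. y \<in> g ` ({0..1} - D) \<and> y \<in> T"
        by blast
    qed
  qed
  then have "X closure_of (\<Union>{E. free_arc X E}) = topspace X"
    by (simp add: Union_free_arcs closure_of_subset_topspace equalityI)
  moreover have "topspace X \<noteq> {}"
    using surj by force
  ultimately show ?thesis
    unfolding peano_graph_def peano_continuum_def using assms compact connected lc by blast
qed

end

text \<open>The endpoints of a closed path are glued by factoring it through \<open>t \<mapsto> exp (2\<pi>it)\<close>.\<close>
lemma open_eulerian_loop_imp_eulerian:
  assumes "open_eulerian X x x"
  shows "eulerian X"
proof -
  obtain g where g: "strongly_irreducible (top_of_set {0..1::real}) X g" "g 0 = x" "g 1 = x"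
    using assms unfolding open_eulerian_def by blast
  define e :: "real \<Rightarrow> complex" where "e t = exp (2 * of_real pi * \<i> * of_real t)" for t
  have e: "continuous_on {0..1} e"
    unfolding e_def by (intro continuous_intros)
  have e_img: "e ` {0..1} = sphere 0 1"
  proof (intro equalityI subsetI)
    fix z :: complex assume "z \<in> sphere 0 1"
    then have "z = e (Arg2pi z / (2 * pi))"
      using Arg2pi_eq[of z] by (simp add: e_def mult_ac)
    moreover have "Arg2pi z / (2 * pi) \<in> {0..1}"
      using Arg2pi_ge_0[of z] Arg2pi_lt_2pi[of z] by simp
    ultimately show "z \<in> e ` {0..1}"
      by blast
  qed (auto simp: e_def norm_exp_eq_Re)
  have e_inj: "g s = g t" if st: "s \<in> {0..1}" "t \<in> {0..1}" "e s = e t" for s t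
  proof -
    obtain n :: int where "2 * of_real pi * \<i> * of_real s = 2 * of_real pi * \<i> * of_real t + of_real (of_int (2 * n) * pi) * \<i>"
      using st(3) unfolding e_def exp_eq by blast
    then have "of_real (2 * pi * s) * \<i> = of_real (2 * pi * (t + of_int n)) * \<i>"
      by (simp add: algebra_simps)
    then have "2 * pi * s = 2 * pi * (t + of_int n)"
      by (simp only: mult_cancel_right of_real_eq_iff) simp
    then have s: "s = t + of_int n"
      by simp
    \<comment> \<open>Points of the unit interval at integer distance either coincide or are its two
      ends, where \<open>g\<close> takes the common value \<open>x\<close>.\<close>
    with st(1,2) have "n = 0 \<or> n = 1 \<or> n = -1"
      by auto
    with s st(1,2) g(2,3) show ?thesis
      by auto
  qed
  have q: "quotient_map (top_of_set {0..1}) (top_of_set (sphere 0 1)) e"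
  proof (rule continuous_closed_imp_quotient_map)
    show "closed_map (top_of_set {0..1}) (top_of_set (sphere 0 1)) e"
      unfolding closed_map_def
      using Abstract_Topology_2.continuous_imp_closed_map[OF _ e e_img] by simp
  qed (use e e_img in auto)
  have "continuous_map (top_of_set {0..1}) X g"
    using g(1) unfolding strongly_irreducible_def by blast
  from quotient_map_lift_exists[OF q this] e_inj
  obtain h where h: "continuous_map (top_of_set (sphere 0 1)) X h" "h ` sphere 0 1 = g ` {0..1}"
    "\<And>t. t \<in> {0..1} \<Longrightarrow> h (e t) = g t"
    by (metis topspace_euclidean_subtopology)
  have "strongly_irreducible (top_of_set (sphere 0 1)) X h"
    unfolding strongly_irreducible_def
  proof (intro conjI allI impI)
    show "h ` topspace (top_of_set (sphere 0 1)) = topspace X"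
      using h(2) g(1) unfolding strongly_irreducible_def by simp
  next
    fix A :: "complex set" assume A: "closedin (top_of_set (sphere 0 1)) A \<and> A \<subset> topspace (top_of_set (sphere 0 1))"
    \<comment> \<open>The preimage under \<open>e\<close> carries a proper closed subset of the
      circle to one of the interval, and \<open>h\<close> on \<open>A\<close> has the same values as
      \<open>g\<close> on \<open>B\<close>.\<close>
    define B where "B = {t \<in> {0..1}. e t \<in> A}"
    have "closedin (top_of_set {0..1}) B"
      unfolding B_def using A e e_img
      using closedin_continuous_map_preimage[of "top_of_set {0..1}" "top_of_set (sphere 0 1)" e A]
      by auto
    moreover have "B \<subset> {0..1}" "e ` B = A"
      using A unfolding e_img[symmetric] B_def by auto
    ultimately have "g ` B \<noteq> topspace X"
      using g(1) unfolding strongly_irreducible_def by simp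
    moreover have "h ` A = g ` B"
      unfolding \<open>e ` B = A\<close>[symmetric] image_image using h(3) by (simp add: B_def)
    ultimately show "h ` A \<noteq> topspace X"
      by simp
  qed (use h in auto)
  then show ?thesis
    unfolding eulerian_def by blast
qed

subsection \<open>Maps from the Cantor set\<close>

lemma continuous_on_of_bool:
  fixes p :: "'a::topological_space \<Rightarrow> bool"
  assumes "continuous_on S p"
  shows "continuous_on S (\<lambda>x. of_bool (p x) :: real)"
proof -
  have "continuous_on UNIV (of_bool :: bool \<Rightarrow> real)"
    by (simp add: continuous_on_open_vimage open_discrete)
  then show ?thesis
    using assms continuous_on_compose2 by blast
qed

text \<open>Uniform limit of functions of finitely many bits. The reindexing \<open>\<phi>\<close>
  makes it possible to read a subsequence of the bits.\<close>

lemma continuous_on_digit_sum: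
  fixes c :: "nat \<Rightarrow> real"
  assumes "summable c" "\<And>n. 0 \<le> c n"
  shows "continuous_on UNIV (\<lambda>x::nat \<Rightarrow> bool. \<Sum>n. c n * of_bool (x (\<phi> n)))"
proof (rule uniform_limit_theorem)
  show "uniform_limit UNIV (\<lambda>n x. \<Sum>i<n. c i * of_bool (x (\<phi> i)))
          (\<lambda>x::nat \<Rightarrow> bool. \<Sum>n. c n * of_bool (x (\<phi> n))) sequentially"
    by (rule Weierstrass_m_test) (use assms in auto)
  have "continuous_on UNIV (\<lambda>x::nat \<Rightarrow> bool. of_bool (x k) :: real)" for k
    by (rule continuous_on_of_bool) simp
  then show "\<forall>\<^sub>F n in sequentially. continuous_on UNIV (\<lambda>x. \<Sum>i<n. c i * of_bool (x (\<phi> i)))"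
    by (intro always_eventually allI continuous_intros)
qed simp

lemma binary_expansion:
  fixes r :: real
  assumes "0 \<le> r" "r \<le> 1"
  obtains x :: "nat \<Rightarrow> bool" where "(\<Sum>n. (1/2) ^ Suc n * of_bool (x n)) = r"
proof (cases "r = 1")
  case True
  \<comment> \<open>For \<open>r = 1\<close> the digits defined below would all vanish, so the
    expansion \<open>0.111...\<close> is used.\<close>
  have "(\<Sum>n. (1/2) ^ Suc n * of_bool True :: real) = 1"
    using power_half_series sums_unique by force
  with True that[of "\<lambda>_. True"] show ?thesis
    by simp
next
  case False
  \<comment> \<open>The last bit of the truncation to \<open>Suc n\<close> binary places. The
    partial sums are then the truncations of \<open>r\<close>, with error at most
    \<open>(1/2) ^ N\<close>.\<close>
  define x where "x n = odd \<lfloor>r * 2 ^ Suc n\<rfloor>" for n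
  have partial: "(\<Sum>n<N. (1/2) ^ Suc n * of_bool (x n)) = real_of_int \<lfloor>r * 2 ^ N\<rfloor> / 2 ^ N" for N
  proof (induction N)
    case 0
    have "\<lfloor>r\<rfloor> = 0"
      using assms False by (simp add: floor_eq_iff)
    show ?case
      by (simp only: power_0 mult_1_right \<open>\<lfloor>r\<rfloor> = 0\<close>) simp
  next
    case (Suc N)
    have "\<lfloor>r * 2 ^ N\<rfloor> = \<lfloor>r * 2 ^ Suc N\<rfloor> div 2"
      using floor_divide_real_eq_div[of 2 "r * 2 ^ Suc N"] by simp
    then have "\<lfloor>r * 2 ^ Suc N\<rfloor> = 2 * \<lfloor>r * 2 ^ N\<rfloor> + of_bool (x N)"
      unfolding x_def by (simp add: odd_iff_mod_2_eq_one) presburger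
    then have "real_of_int \<lfloor>r * 2 ^ Suc N\<rfloor> = 2 * of_int \<lfloor>r * 2 ^ N\<rfloor> + of_bool (x N)"
      by simp
    with Suc show ?case
      by (simp add: field_simps power_divide del: of_bool_eq_iff)
  qed
  have "(\<lambda>N. of_int \<lfloor>r * 2 ^ N\<rfloor> / 2 ^ N) \<longlonglongrightarrow> r"
  proof (rule tendsto_sandwich)
    show "\<forall>\<^sub>F N in sequentially. r - (1/2) ^ N \<le> of_int \<lfloor>r * 2 ^ N\<rfloor> / 2 ^ N"
    proof (intro always_eventually allI)
      fix N :: nat
      have "r * 2 ^ N - 1 \<le> of_int \<lfloor>r * 2 ^ N\<rfloor>"
        by linarith
      then have "(r * 2 ^ N - 1) / 2 ^ N \<le> of_int \<lfloor>r * 2 ^ N\<rfloor> / 2 ^ N"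
        by (rule divide_right_mono) simp
      then show "r - (1/2) ^ N \<le> of_int \<lfloor>r * 2 ^ N\<rfloor> / 2 ^ N"
        by (simp add: diff_divide_distrib power_divide)
    qed
    show "\<forall>\<^sub>F N in sequentially. of_int \<lfloor>r * 2 ^ N\<rfloor> / 2 ^ N \<le> r"
      by (intro always_eventually allI) (simp add: divide_le_eq)
    show "(\<lambda>N. r - (1/2) ^ N) \<longlonglongrightarrow> r"
      using tendsto_diff[OF tendsto_const LIMSEQ_power_zero[of "1/2 :: real"], of r] by simp
  qed simp
  then have "(\<lambda>n. (1/2) ^ Suc n * of_bool (x n)) sums r"
    unfolding sums_def partial .
  then show ?thesis
    using that sums_unique by metis
qed

text \<open>The middle-thirds Cantor set, scaled by \<open>1/4\<close> and moved into
  \<open>{1/4..1/2}\<close>. This leaves room on the right for loops and at both ends for the points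
  \<open>0\<close> and \<open>1\<close>.\<close>

definition cantor_code :: "(nat \<Rightarrow> bool) \<Rightarrow> real" where
  "cantor_code x = 1/4 + (\<Sum>n. 1/6 * (1/3) ^ n * of_bool (x n))"

lemma summable_cantor: "summable (\<lambda>n. 1/6 * (1/3) ^ n :: real)"
  by (intro summable_mult summable_geometric) simp

lemma summable_cantor_digits: "summable (\<lambda>n. 1/6 * (1/3) ^ n * of_bool (x n) :: real)"
  by (rule summable_comparison_test'[OF summable_cantor, of 0]) simp

lemma continuous_on_cantor_code: "continuous_on S cantor_code"
proof -
  have "continuous_on UNIV cantor_code"
    unfolding cantor_code_def
    by (intro continuous_on_add continuous_on_const continuous_on_digit_sum[where \<phi> = "\<lambda>n. n"] summable_cantor) simp
  then show ?thesis
    by (rule continuous_on_subset) simp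
qed

lemma cantor_code_range: "cantor_code x \<in> {1/4..1/2}"
proof -
  have "(\<Sum>n. 1/6 * (1/3) ^ n * of_bool (x n)) \<le> (\<Sum>n. 1/6 * (1/3) ^ n :: real)"
    by (intro suminf_le summable_cantor_digits summable_cantor) simp
  moreover have "(\<Sum>n. 1/6 * (1/3) ^ n :: real) = 1/4"
    by (subst suminf_mult) (simp_all add: summable_geometric suminf_geometric)
  moreover have "0 \<le> (\<Sum>n. 1/6 * (1/3) ^ n * of_bool (x n) :: real)"
    by (intro suminf_nonneg summable_cantor_digits) simp
  ultimately show ?thesis
    by (simp add: cantor_code_def)
qed

text \<open>The weight of digit \<open>n\<close> is twice the total weight of all later digits, so
  the first difference decides the order.\<close>

lemma cantor_code_less:
  assumes "\<And>k. k < n \<Longrightarrow> x k = y k" "\<not> x n" "y n"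
  shows "cantor_code x < cantor_code y"
proof -
  define s where "s x = (\<Sum>k. 1/6 * (1/3) ^ (k + Suc n) * of_bool (x (k + Suc n)) :: real)" for x
  have split: "cantor_code x = 1/4 + s x + (\<Sum>k<n. 1/6 * (1/3) ^ k * of_bool (x k)) + 1/6 * (1/3) ^ n * of_bool (x n)" for x
    unfolding cantor_code_def s_def
    by (subst suminf_split_initial_segment[OF summable_cantor_digits, of _ "Suc n"]) simp
  have "s x \<le> (\<Sum>k. 1/6 * (1/3) ^ (k + Suc n))"
    unfolding s_def using summable_cantor summable_cantor_digits
    by (intro suminf_le summable_ignore_initial_segment[of _ "Suc n"]) auto
  also have "\<dots> = (\<Sum>k. 1/6 * (1/3) ^ Suc n * (1/3) ^ k :: real)"
    by (intro suminf_cong) (simp add: power_add)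
  also have "\<dots> = 1/6 * (1/3) ^ Suc n * (3/2)"
    by (subst suminf_mult) (simp_all add: summable_geometric suminf_geometric)
  also have "\<dots> < 1/6 * (1/3) ^ n"
    by simp
  finally have "s x < 1/6 * (1/3) ^ n" .
  moreover have "0 \<le> s y"
    unfolding s_def using summable_cantor_digits
    by (intro suminf_nonneg summable_ignore_initial_segment[of _ "Suc n"]) auto
  ultimately show ?thesis
    using assms by (simp add: split)
qed

lemma inj_cantor_code: "inj cantor_code"
proof (rule injI)
  fix x y assume eq: "cantor_code x = cantor_code y"
  show "x = y"
  proof (rule ccontr)
    assume "x \<noteq> y"
    then have ex: "\<exists>n. x n \<noteq> y n"
      by auto
    define n where "n = (LEAST n. x n \<noteq> y n)"
    have "x n \<noteq> y n" "\<And>k. k < n \<Longrightarrow> x k = y k"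
      using LeastI_ex[OF ex] not_less_Least unfolding n_def by blast+
    then show False
      using cantor_code_less[of n x y] cantor_code_less[of n y x] eq by (cases "x n") auto
  qed
qed

lemma compact_UNIV_bool_seq: "compact (UNIV :: (nat \<Rightarrow> bool) set)"
proof -
  have "compactin (product_topology (\<lambda>_. euclidean) UNIV) (PiE UNIV (\<lambda>_::nat. UNIV :: bool set))"
    unfolding compactin_PiE by (simp add: finite_imp_compact)
  then show ?thesis
    by (simp add: euclidean_product_topology)
qed

lemma continuous_on_cantor_decode: "continuous_on (range cantor_code) (inv cantor_code)"
  using continuous_on_inv[OF continuous_on_cantor_code compact_UNIV_bool_seq] inj_cantor_code by auto

text \<open>Each digit is a continuous two-valued function of the code, hence constant on any
  interval of codes. All points of such an interval would have the same digits.\<close>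

lemma interior_cantor: "interior (range cantor_code) = {}"
proof (rule interior_emptyI, rule ccontr)
  fix a b :: real assume "a < b" and "\<not> (\<exists>t\<in>{a<..<b}. t \<notin> range cantor_code)"
  then have sub: "{a<..<b} \<subseteq> range cantor_code"
    by blast
  have const: "inv cantor_code s n = inv cantor_code t n" if "s \<in> {a<..<b}" "t \<in> {a<..<b}" for s t n
  proof -
    have "continuous_on {a<..<b} (\<lambda>t. inv cantor_code t n)"
      using continuous_on_product_then_coordinatewise[OF continuous_on_subset[OF continuous_on_cantor_decode sub]] .
    then have "continuous_on {a<..<b} (\<lambda>t. of_bool (inv cantor_code t n) :: real)"
      by (rule continuous_on_of_bool)
    moreover have "finite ((\<lambda>t. of_bool (inv cantor_code t n) :: real) ` {a<..<b})"
      by (rule finite_subset[of _ "{0,1}"]) auto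
    ultimately have "(\<lambda>t. of_bool (inv cantor_code t n) :: real) constant_on {a<..<b}"
      by (intro continuous_finite_range_constant) auto
    then have "(of_bool (inv cantor_code s n) :: real) = of_bool (inv cantor_code t n)"
      using that unfolding constant_on_def by metis
    then show ?thesis
      by (simp only: of_bool_eq_iff)
  qed
  obtain s where s: "a < s" "s < b"
    using dense[OF \<open>a < b\<close>] by blast
  obtain t where t: "s < t" "t < b"
    using dense[OF s(2)] by blast
  have "inv cantor_code s = inv cantor_code t"
    using const[of s t] s t by auto
  moreover have "s \<in> range cantor_code" "t \<in> range cantor_code"
    using sub s t by auto
  ultimately have "s = t"
    by (metis f_inv_into_f)
  with t show False
    by simp
qed

text \<open>A bit sequence is split by \<open>prod_encode\<close> into countably many, each read as
  a binary expansion of one coordinate. This continuous map reaches all of \<open>K\<close>; it is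
  restricted to the preimage of \<open>K\<close> and transported to the line by
  \<open>cantor_code\<close>.\<close>

lemma cantor_surjection:
  fixes K :: "(nat \<Rightarrow> real) set"
  assumes "compact K" "K \<subseteq> UNIV \<rightarrow> {0..1}"
  obtains C :: "real set" and f where "compact C" "C \<subseteq> {1/4..1/2}" "interior C = {}"
    "continuous_on C f" "f ` C = K"
proof -
  define s :: "(nat \<Rightarrow> bool) \<Rightarrow> nat \<Rightarrow> real" where
    "s x m = (\<Sum>n. (1/2) ^ Suc n * of_bool (x (prod_encode (m, n))))" for x m
  have s_cont: "continuous_on UNIV s"
  proof (rule continuous_on_coordinatewise_then_product)
    fix m
    have "summable (\<lambda>n. (1/2) ^ Suc n :: real)"
      using power_half_series sums_summable by blast
    then show "continuous_on UNIV (\<lambda>x. s x m)"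
      unfolding s_def by (rule continuous_on_digit_sum) simp
  qed
  have s_surj: "\<exists>x. s x = k" if "k \<in> K" for k
  proof -
    have "\<exists>x. (\<Sum>n. (1/2) ^ Suc n * of_bool (x n)) = k m" for m
    proof -
      have "0 \<le> k m" "k m \<le> 1"
        using assms(2) that by (auto simp: Pi_iff subset_iff)
      then show ?thesis
        using binary_expansion by metis
    qed
    then obtain x where x: "\<And>m. (\<Sum>n. (1/2) ^ Suc n * of_bool (x m n)) = k m"
      by metis
    have "s (\<lambda>i. case prod_decode i of (m, n) \<Rightarrow> x m n) = k"
      using x by (auto simp: s_def)
    then show ?thesis
      by blast
  qed
  define C where "C = cantor_code ` (s -` K)"
  have "closed (s -` K)"
    using assms(1) s_cont by (simp add: compact_imp_closed closed_vimage continuous_on_eq_continuous_at)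
  then have "compact (s -` K)"
    using compact_UNIV_bool_seq compact_Int_closed by fastforce
  then have "compact C"
    unfolding C_def by (intro compact_continuous_image continuous_on_cantor_code)
  moreover have sub: "C \<subseteq> range cantor_code"
    unfolding C_def by blast
  moreover have "continuous_on C (s \<circ> inv cantor_code)"
    using continuous_on_subset[OF continuous_on_cantor_decode sub] continuous_on_subset[OF s_cont]
    by (intro continuous_on_compose) auto
  moreover have "(s \<circ> inv cantor_code) ` C = K"
    using s_surj inj_cantor_code unfolding C_def by (fastforce simp: image_iff)
  ultimately show ?thesis
    using that[of C "s \<circ> inv cantor_code"] interior_cantor interior_mono[OF sub] cantor_code_range by blast
qed

subsection \<open>The ground space inside the curve\<close>

text \<open>To the right of each left gap end \<open>a\<close> of \<open>C\<close> the points \<open>a + 1/n\<close> lying in the left half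
  of the gap are added; consecutive ones retract to the same point \<open>a\<close>.\<close>
lemma insert_loops:
  fixes C :: "real set"
  assumes "compact C" "C \<noteq> {}" "C \<subseteq> {1/4..1/2}" and interior_C: "interior C = {}"
  obtains D \<rho> where "closed D" "C \<subseteq> D" "D \<subseteq> {1/4..3/4}" "interior D = {}"
    "continuous_on D \<rho>" "\<rho> ` D = C" "\<And>c. c \<in> C \<Longrightarrow> \<rho> c = c"
    "\<And>c e. \<lbrakk>c \<in> C; e > 0\<rbrakk> \<Longrightarrow>
       \<exists>p q. p < q \<and> p \<in> D \<and> q \<in> D \<and> {p<..<q} \<inter> D = {} \<and> \<rho> p = \<rho> q \<and> {p..q} \<subseteq> {c<..<c+e}"
proof -
  obtain m where m: "m \<in> C" "\<And>c. c \<in> C \<Longrightarrow> m \<le> c"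
    using compact_attains_inf[OF assms(1,2)] by blast
  \<comment> \<open>The function \<open>\<rho>\<close> chosen from this sends \<open>t\<close> to
    the last point of \<open>C\<close> up to \<open>t\<close>, which off \<open>C\<close> is the
    left end of the gap around \<open>t\<close>.\<close>
  have "\<exists>a. a \<in> C \<and> a \<le> t \<and> (\<forall>c\<in>C. c \<le> t \<longrightarrow> c \<le> a)" if "m \<le> t" for t
  proof -
    have "compact (C \<inter> {..t})" "C \<inter> {..t} \<noteq> {}"
      using assms(1) m that by (auto intro: compact_Int_closed)
    from compact_attains_sup[OF this] show ?thesis
      by auto
  qed
  then obtain \<rho> where \<rho>: "\<And>t. m \<le> t \<Longrightarrow> \<rho> t \<in> C" "\<And>t. m \<le> t \<Longrightarrow> \<rho> t \<le> t"
    "\<And>t c. \<lbrakk>m \<le> t; c \<in> C; c \<le> t\<rbrakk> \<Longrightarrow> c \<le> \<rho> t"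
    by metis
  have \<rho>_C: "\<rho> c = c" if "c \<in> C" for c
    using \<rho>[of c] m that by (simp add: order_antisym)
  \<comment> \<open>Off \<open>C\<close> the map \<open>\<rho>\<close> is locally constant.\<close>
  have \<rho>_eq: "\<rho> s = \<rho> t" if "m \<le> s" "m \<le> t" "ball t e \<inter> C = {}" "s \<in> ball t e" for s t e
  proof (rule order_antisym)
    have "\<rho> s \<notin> ball t e" "\<rho> t \<notin> ball t e"
      using \<rho>(1) that by blast+
    then have "\<rho> s \<le> t" "\<rho> t \<le> s"
      using \<rho>(2)[of s] \<rho>(2)[of t] that by (auto simp: dist_real_def)
    then show "\<rho> s \<le> \<rho> t" "\<rho> t \<le> \<rho> s"
      using \<rho> that by auto
  qed
  have gap_ball: "\<exists>e>0. ball t e \<inter> C = {}" if t: "t \<notin> C" for t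
  proof -
    have "open (- C)"
      using compact_imp_closed[OF assms(1)] by (simp add: open_Compl)
    then obtain e where "e > 0" "ball t e \<subseteq> - C"
      using t openE by blast
    then show ?thesis
      by blast
  qed
  \<comment> \<open>\<open>0 \<in> H\<close> because \<open>1/0 = 0\<close>.\<close>
  define H where "H = range (\<lambda>n. 1 / real n)"
  have "0 \<in> H"
    unfolding H_def by (rule image_eqI[of _ _ 0]) simp_all
  then have "closed H"
    using compact_imp_closed[OF compact_sequence_with_limit[OF lim_1_over_n[where 'a = real]]]
    by (simp add: H_def insert_absorb)
  \<comment> \<open>For \<open>a = \<rho> s\<close> the second condition says that \<open>a\<close>
    is a nearest point of \<open>C\<close> to \<open>s\<close>, so that \<open>s\<close> lies in the
    left half of its gap. Continuity of \<open>\<rho>\<close> at points of \<open>C\<close> rests on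
    this.\<close>
  define W where "W a = {s. s - a \<in> H \<and> (\<forall>c\<in>C. s - a \<le> \<bar>s - c\<bar>)}" for a
  have "closed ((\<lambda>s. s - a) -` H)" for a
    using \<open>closed H\<close> by (intro closed_vimage continuous_intros)
  moreover have "closed (\<Inter>c\<in>C. {s. s - a \<le> \<bar>s - c\<bar>})" for a
    by (intro closed_INT ballI closed_Collect_le continuous_intros)
  moreover have "W a = (\<lambda>s. s - a) -` H \<inter> (\<Inter>c\<in>C. {s. s - a \<le> \<bar>s - c\<bar>})" for a
    unfolding W_def by auto
  ultimately have closed_W: "closed (W a)" for a
    by (simp add: closed_Int)
  \<comment> \<open>The bound \<open>3/4\<close> cuts off the unbounded gap to the right of
    \<open>C\<close>.\<close>
  define D where "D = {t. m \<le> t \<and> t \<le> 3/4 \<and> t \<in> W (\<rho> t)}"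
  have "C \<subseteq> D"
    using assms(3) m \<rho>_C \<open>0 \<in> H\<close> by (auto simp: D_def W_def subset_iff)
  have "closed D"
    unfolding closed_sequential_limits
  proof (intro allI impI)
    fix x t assume x: "(\<forall>n. x n \<in> D) \<and> x \<longlonglongrightarrow> t"
    have t: "m \<le> t" "t \<le> 3/4"
      using x LIMSEQ_le_const[of x t m] LIMSEQ_le_const2[of x t "3/4"] unfolding D_def by blast+
    show "t \<in> D"
    proof (cases "t \<in> C")
      case False
      \<comment> \<open>Near a limit off \<open>C\<close> the value of \<open>\<rho>\<close> is
        fixed, so the sequence eventually stays in the single closed set
        \<open>W (\<rho> t)\<close>.\<close>
      then obtain e where e: "e > 0" "ball t e \<inter> C = {}"
        using gap_ball by blast
      have "\<forall>\<^sub>F n in sequentially. x n \<in> ball t e"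
        by (rule topological_tendstoD) (use x e(1) in auto)
      then have "\<forall>\<^sub>F n in sequentially. x n \<in> W (\<rho> t)"
      proof eventually_elim
        case (elim n)
        then have "\<rho> (x n) = \<rho> t"
          using \<rho>_eq[OF _ t(1) e(2) elim] x by (simp add: D_def)
        moreover have "x n \<in> W (\<rho> (x n))"
          using x by (simp add: D_def)
        ultimately show ?case
          by simp
      qed
      then have "t \<in> W (\<rho> t)"
        by (rule Lim_in_closed_set[OF closed_W]) (use x in auto)
      then show ?thesis
        using t by (simp add: D_def)
    qed (use \<open>C \<subseteq> D\<close> in blast)
  qed
  have "continuous_on D \<rho>"
    unfolding continuous_on_iff
  proof (intro ballI allI impI)
    fix t e :: real assume t: "t \<in> D" and e: "e > 0"
    show "\<exists>d>0. \<forall>s\<in>D. dist s t < d \<longrightarrow> dist (\<rho> s) (\<rho> t) < e"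
    proof (cases "t \<in> C")
      case True
      have "dist (\<rho> s) (\<rho> t) < e" if "s \<in> D" "dist s t < e / 2" for s
      proof -
        \<comment> \<open>As \<open>\<rho> s\<close> is a nearest point of \<open>C\<close>, its
          distance from \<open>t\<close> is at most twice that of \<open>s\<close>.\<close>
        have "s - \<rho> s \<le> \<bar>s - t\<bar>" "\<rho> s \<le> s"
          using that(1) True \<rho>(2) by (auto simp: D_def W_def)
        then show ?thesis
          using that(2) unfolding dist_real_def \<rho>_C[OF True] by arith
      qed
      then show ?thesis
        using e by (intro exI[of _ "e / 2"]) auto
    next
      case False
      then obtain d where d: "d > 0" "ball t d \<inter> C = {}"
        using gap_ball by blast
      then have "\<rho> s = \<rho> t" if "s \<in> D" "dist s t < d" for s
        using \<rho>_eq[of s t d] t that by (simp add: D_def dist_commute)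
      then show ?thesis
        using d(1) e by (intro exI[of _ d]) auto
    qed
  qed
  have "interior D = {}"
  proof (rule interior_emptyI)
    fix a b :: real assume ab: "a < b"
    obtain t where t: "a < t" "t < b" "t \<notin> C"
      using ex_notin_if_interior_empty[OF interior_C ab] by auto
    obtain e where e: "e > 0" "ball t e \<inter> C = {}"
      using gap_ball[OF t(3)] by blast
    \<comment> \<open>If \<open>m \<le> t\<close>, then near \<open>t\<close> the set
      \<open>D\<close> lies in the countable translate of \<open>H\<close> by
      \<open>\<rho> t\<close>, which cannot fill an interval.\<close>
    have "countable ((\<lambda>h. \<rho> t + h) ` H)"
      unfolding H_def by simp
    moreover have "uncountable {t<..<min b (t + e)}"
      using t e uncountable_open_interval by simp
    ultimately have "\<not> {t<..<min b (t + e)} \<subseteq> (\<lambda>h. \<rho> t + h) ` H"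
      using countable_subset by metis
    then obtain s where s: "s \<in> {t<..<min b (t + e)}" "s \<notin> (\<lambda>h. \<rho> t + h) ` H"
      by (meson subsetI)
    have sH: "s - \<rho> t \<notin> H"
    proof
      assume "s - \<rho> t \<in> H"
      then have "\<rho> t + (s - \<rho> t) \<in> (\<lambda>h. \<rho> t + h) ` H"
        by (rule imageI)
      with s(2) show False
        by simp
    qed
    show "\<exists>t\<in>{a<..<b}. t \<notin> D"
    proof (cases "m \<le> t")
      case True
      then have "\<rho> s = \<rho> t"
        using \<rho>_eq[of s t e] s e by (simp add: dist_real_def)
      then have "s \<notin> D"
        using sH by (simp add: D_def W_def)
      then show ?thesis
        using s t by auto
    next
      case False
      then have "t \<notin> D"
        by (simp add: D_def)
      then show ?thesis
        using t by auto
    qed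
  qed
  moreover have "\<rho> ` D = C"
  proof (intro equalityI subsetI)
    fix c assume "c \<in> C"
    then show "c \<in> \<rho> ` D"
      using \<rho>_C \<open>C \<subseteq> D\<close> by (intro image_eqI[of c \<rho> c]) auto
  qed (use \<rho>(1) in \<open>auto simp: D_def\<close>)
  moreover have "\<exists>p q. p < q \<and> p \<in> D \<and> q \<in> D \<and> {p<..<q} \<inter> D = {} \<and> \<rho> p = \<rho> q \<and> {p..q} \<subseteq> {c<..<c+e}"
    if c: "c \<in> C" and e: "e > 0" for c e
  proof -
    \<comment> \<open>As \<open>c\<close> is at most \<open>1/2\<close>, the cap \<open>1/4\<close>
      keeps \<open>t\<close> below \<open>3/4\<close>. The gap around \<open>t\<close> may begin to
      the right of \<open>c\<close>; its left end \<open>a\<close> still lies in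
      \<open>{c..<t}\<close>.\<close>
    obtain t where t: "c < t" "t < c + min e (1/4)" "t \<notin> C"
      using ex_notin_if_interior_empty[OF interior_C, of c "c + min e (1/4)"] e by auto
    define a where "a = \<rho> t"
    have mt: "m \<le> t"
      using m(2)[OF c] t by simp
    have a: "a \<in> C" "a < t" "c \<le> a" "\<And>c'. \<lbrakk>c' \<in> C; c' \<le> t\<rbrakk> \<Longrightarrow> c' \<le> a"
      using \<rho>[OF mt] c t(1,3) unfolding a_def by (auto simp: less_le)
    have \<rho>_a: "\<rho> s = a" if "a \<le> s" "s < t" for s
      using \<rho>[of s] a m(2)[OF a(1)] that by (intro order_antisym) auto
    \<comment> \<open>No point of \<open>C\<close> lies in \<open>{a<..t}\<close>, and
      \<open>2 * r < t - a\<close> makes \<open>a + r\<close> closer to \<open>a\<close> than to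
      anything beyond \<open>t\<close>.\<close>
    have in_D: "a + r \<in> D" if r: "r \<in> H" "0 < r" "2 * r < t - a" for r
    proof -
      have "a + r < t"
        using r(3) a(2) by linarith
      moreover from this have "\<rho> (a + r) = a"
        using r(2) by (intro \<rho>_a) auto
      moreover have "r \<le> \<bar>a + r - c'\<bar>" if c': "c' \<in> C" for c'
      proof (cases "c' \<le> t")
        case True
        then show ?thesis
          using a(4)[OF c'] by simp
      next
        case False
        then show ?thesis
          using r(3) by linarith
      qed
      moreover have "t \<le> 3/4"
        using t c assms(3) by (auto simp: subset_iff)
      moreover have "m \<le> a + r"
        using m(2)[OF a(1)] r(2) by simp
      ultimately show ?thesis
        using r(1) by (auto simp: D_def W_def)
    qed
    obtain n where n: "n > 0" "2 * (1 / real n) < t - a"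
    proof -
      obtain k where "inverse (real (Suc k)) < (t - a) / 2"
        using reals_Archimedean[of "(t - a) / 2"] a(2) by auto
      then show ?thesis
        by (intro that[of "Suc k"]) (simp_all add: field_simps)
    qed
    define p where "p = a + 1 / real (Suc n)"
    define q where "q = a + 1 / real n"
    have "1 / real (Suc n) < 1 / real n"
      using n(1) by (simp add: frac_less2)
    moreover have "0 < 1 / real (Suc n)" "1 / real (Suc n) \<in> H" "1 / real n \<in> H"
      unfolding H_def by (simp, rule rangeI, rule rangeI)
    ultimately have pq: "a < p" "p < q" "q < t" "p \<in> D" "q \<in> D"
      using n(2) in_D[of "1 / real n"] in_D[of "1 / real (Suc n)"] unfolding p_def q_def by linarith+
    have gap: "s \<notin> D" if "p < s" "s < q" for s
    proof
      assume "s \<in> D"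
      then have "s - a \<in> H"
        using \<rho>_a[of s] pq that by (simp add: D_def W_def)
      then obtain k where k: "s - a = 1 / real k"
        unfolding H_def by blast
      \<comment> \<open>A point of \<open>D\<close> inside the gap would give an integer strictly
        between \<open>n\<close> and \<open>Suc n\<close>.\<close>
      have "1 / real (Suc n) < 1 / real k" "1 / real k < 1 / real n"
        using that unfolding p_def q_def k[symmetric] by auto
      moreover from this have "0 < k"
        using n(1) by (cases "k = 0") auto
      ultimately have "real k < real (Suc n)" "real n < real k"
        using n(1) by (simp_all add: field_simps)
      then show False
        by simp
    qed
    have "\<rho> p = \<rho> q"
      using \<rho>_a pq by simp
    moreover have "{p..q} \<subseteq> {c<..<c+e}"
      using pq a(3) t(2) by auto
    ultimately show ?thesis
      using pq gap by (intro exI[of _ p] exI[of _ q]) auto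
  qed
  moreover have "D \<subseteq> {1/4..3/4}"
    using m(1) assms(3) by (auto simp: D_def subset_iff)
  ultimately show ?thesis
    using that \<open>closed D\<close> \<open>C \<subseteq> D\<close> \<open>continuous_on D \<rho>\<close> \<rho>_C by blast
qed

section \<open>Embedding a compact metrizable space into the Hilbert cube\<close>

lemma compact_metrizable_imp_cube_embedding:
  fixes Z :: "'a topology"
  assumes "compact_space Z" "metrizable_space Z"
  obtains i :: "'a \<Rightarrow> nat \<Rightarrow> real" where "continuous_map Z euclidean i" "inj_on i (topspace Z)"
    "\<And>z n. i z n \<in> {0..1}"
proof (cases "topspace Z = {}")
  case True
  then show ?thesis
    using that[of "\<lambda>_ _. 0"] by auto
next
  case False
  obtain M d where "Metric_space M d" and Z: "Z = Metric_space.mtopology M d"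
    using assms(2) unfolding metrizable_space_def by blast
  interpret Metric_space M d
    by fact
  have M: "topspace Z = M"
    by (simp add: Z)
  have "mtotally_bounded M"
    using assms(1) compactin_imp_mtotally_bounded by (simp add: Z compact_space_def)
  then have "\<exists>K. finite K \<and> K \<subseteq> M \<and> M \<subseteq> (\<Union>x\<in>K. mball x (1 / Suc n))" for n :: nat
    unfolding mtotally_bounded_def by simp
  then obtain K where K: "\<And>n. finite (K n)" "\<And>n. K n \<subseteq> M" "\<And>n::nat. M \<subseteq> (\<Union>x\<in>K n. mball x (1 / Suc n))"
    by metis
  \<comment> \<open>The union of finite \<open>1 / Suc n\<close>-nets is a countable dense
    set.\<close>
  define Q where "Q = (\<Union>n. K n)"
  have "countable Q"
    unfolding Q_def using K(1) by (simp add: countable_finite)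
  have "Q \<subseteq> M"
    using K(2) by (auto simp: Q_def)
  have dense: "\<exists>q\<in>Q. d q z < e" if z: "z \<in> M" and e: "e > 0" for z e
  proof -
    obtain n where n: "1 / Suc n < e"
      using reals_Archimedean[OF e] by (auto simp: inverse_eq_divide)
    obtain q where "q \<in> K n" "z \<in> mball q (1 / Suc n)"
      using K(3) z by blast
    then show ?thesis
      using n by (intro bexI[of _ q]) (auto simp: Q_def)
  qed
  then have "Q \<noteq> {}"
    using False M zero_less_one by blast
  \<comment> \<open>The coordinates are the distances to an enumeration of \<open>Q\<close>,
    truncated at \<open>1\<close> to stay in the unit interval.\<close>
  define i where "i z n = min 1 \<bar>d z (from_nat_into Q n)\<bar>" for z n
  have "continuous_map Z euclideanreal (\<lambda>z. i z n)" for n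
  proof -
    have "from_nat_into Q n \<in> M"
      using from_nat_into[OF \<open>Q \<noteq> {}\<close>] \<open>Q \<subseteq> M\<close> by blast
    then have "continuous_map mtopology euclideanreal (\<lambda>z. d z (from_nat_into Q n))"
      using continuous_map_mdist[of mtopology "metric (M, d)" "\<lambda>z. z" "\<lambda>_. from_nat_into Q n"]
      by simp
    then show ?thesis
      unfolding i_def Z by (intro continuous_map_real_min continuous_map_real_abs) auto
  qed
  then have "continuous_map Z euclidean i"
    using continuous_map_coordinatewise_then_product[of UNIV Z "\<lambda>_. euclideanreal" i]
    by (simp add: euclidean_product_topology)
  moreover have "inj_on i (topspace Z)"
  proof (rule inj_onI, rule ccontr)
    fix w z assume wz: "w \<in> topspace Z" "z \<in> topspace Z" "i w = i z" "w \<noteq> z"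
    \<comment> \<open>A point of \<open>Q\<close> this close to \<open>z\<close> has distance below
      \<open>1/2\<close>, where truncation has no effect. Equal coordinates put it equally close to
      \<open>w\<close>, against the triangle inequality.\<close>
    then have "0 < min 1 (d w z) / 2"
      using M by simp
    then obtain q where q: "q \<in> Q" "d q z < min 1 (d w z) / 2"
      using dense[of z] wz M by blast
    then obtain n where n: "q = from_nat_into Q n"
      using from_nat_into_surj[OF \<open>countable Q\<close>] by metis
    have "min 1 (d w q) = min 1 (d z q)"
      using fun_cong[OF wz(3), of n] by (simp add: i_def n)
    moreover have "d w z \<le> d w q + d q z" "d z q = d q z"
      using triangle[of w q z] commute[of z q] wz M q(1) \<open>Q \<subseteq> M\<close> by auto
    ultimately show False
      using q(2) by linarith
  qed
  moreover have "i z n \<in> {0..1}" for z n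
    by (simp add: i_def)
  ultimately show ?thesis
    using that by blast
qed

text \<open>The ends \<open>0\<close> and \<open>1\<close> are added as isolated points of the
  parameter set with the prescribed values \<open>x\<close> and \<open>y\<close>. The loops lie
  between \<open>1/4\<close> and \<open>3/4\<close>, so their gaps are unaffected.\<close>

lemma ground_curve:
  fixes K :: "(nat \<Rightarrow> real) set"
  assumes "compact K" "K \<subseteq> UNIV \<rightarrow> {0..1}" "x \<in> K" "y \<in> K"
  obtains D :: "real set" and F :: "real \<Rightarrow> nat \<Rightarrow> real"
  where "closed D" "D \<subseteq> {0..1}" "0 \<in> D" "1 \<in> D"
    "interior D = {}"
    "continuous_on UNIV F" "F ` D = K" "F 0 = x" "F 1 = y"
    "\<forall>z\<in>K. \<exists>c\<in>D. F c = z \<and> (\<forall>e>0. \<exists>p q. p < q \<and> p \<in> D \<and> q \<in> D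
        \<and> {p<..<q} \<inter> D = {} \<and> F p = F q \<and> {p..q} \<subseteq> {c<..<c+e})"
proof -
  obtain C :: "real set" and f where C: "compact C" "C \<subseteq> {1/4..1/2}" "interior C = {}"
    and f: "continuous_on C f" "f ` C = K"
    using cantor_surjection[OF assms(1,2)] by metis
  have "C \<noteq> {}"
    using f(2) assms(3) by auto
  obtain D \<rho> where D: "closed D" "C \<subseteq> D" "D \<subseteq> {1/4..3/4}" "interior D = {}"
    and \<rho>: "continuous_on D \<rho>" "\<rho> ` D = C" "\<And>c. c \<in> C \<Longrightarrow> \<rho> c = c"
    and loops: "\<And>c e. \<lbrakk>c \<in> C; e > 0\<rbrakk> \<Longrightarrow>
       \<exists>p q. p < q \<and> p \<in> D \<and> q \<in> D \<and> {p<..<q} \<inter> D = {} \<and> \<rho> p = \<rho> q \<and> {p..q} \<subseteq> {c<..<c+e}"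
    using insert_loops[OF C(1) \<open>C \<noteq> {}\<close> C(2,3)] by blast
  define D' where "D' = {0,1} \<union> D"
  define f' where "f' t = (if t = 0 then x else if t = 1 then y else f (\<rho> t))" for t
  have f'_D: "f' t = f (\<rho> t)" if "t \<in> D" for t
    using D(3) that by (auto simp: f'_def)
  have "continuous_on D (\<lambda>t. f (\<rho> t))"
    using continuous_on_compose2[OF f(1) \<rho>(1)] \<rho>(2) by simp
  then have "continuous_on D f'"
    using f'_D continuous_on_cong[of D D f' "\<lambda>t. f (\<rho> t)"] by simp
  then have cont: "continuous_on D' f'"
    unfolding D'_def by (intro continuous_on_closed_Un D(1)) (auto intro: continuous_on_finite)
  have "closed D'"
    unfolding D'_def using D(1) by (intro closed_Un) auto
  then have "closedin (top_of_set UNIV) D'"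
    by simp
  \<comment> \<open>Tietze extension is applied to each coordinate separately.\<close>
  have "\<exists>g. continuous_on UNIV g \<and> (\<forall>t\<in>D'. g t = f' t n)" for n
    using Tietze_unbounded[OF continuous_on_product_then_coordinatewise[OF cont] \<open>closedin _ _\<close>] by metis
  then obtain G where G: "\<And>n. continuous_on UNIV (G n)" "\<And>n t. t \<in> D' \<Longrightarrow> G n t = f' t n"
    by metis
  define F where "F t n = G n t" for t n
  have "continuous_on UNIV F"
    unfolding F_def by (intro continuous_on_coordinatewise_then_product G(1))
  have F: "F t = f' t" if "t \<in> D'" for t
    using G(2)[OF that] by (auto simp: F_def)
  have F_D: "F t = f (\<rho> t)" if "t \<in> D" for t
    using F[of t] f'_D that by (simp add: D'_def)
  have "F 0 = x" "F 1 = y"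
    using F[of 0] F[of 1] by (simp_all add: D'_def f'_def)
  have "F ` D = K"
  proof -
    have "F ` D = f ` \<rho> ` D"
      unfolding image_image using F_D by (intro image_cong) auto
    then show ?thesis
      using \<rho>(2) f(2) by simp
  qed
  then have "F ` D' = K"
    using \<open>F 0 = x\<close> \<open>F 1 = y\<close> assms(3,4) by (auto simp: D'_def)
  have "\<exists>c\<in>D'. F c = z \<and> (\<forall>e>0. \<exists>p q. p < q \<and> p \<in> D' \<and> q \<in> D'
        \<and> {p<..<q} \<inter> D' = {} \<and> F p = F q \<and> {p..q} \<subseteq> {c<..<c+e})" if z: "z \<in> K" for z
  proof -
    obtain c where c: "c \<in> C" "f c = z"
      using z f(2) by blast
    have "\<exists>p q. p < q \<and> p \<in> D' \<and> q \<in> D' \<and> {p<..<q} \<inter> D' = {} \<and> F p = F q \<and> {p..q} \<subseteq> {c<..<c+e}"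
      if e: "e > 0" for e
    proof -
      obtain p q where pq: "p < q" "p \<in> D" "q \<in> D" "{p<..<q} \<inter> D = {}" "\<rho> p = \<rho> q" "{p..q} \<subseteq> {c<..<c+e}"
        using loops[OF c(1) e] by blast
      have "0 < p" "q < 1"
        using pq(2,3) D(3) by auto
      then have "{p<..<q} \<inter> D' = {}"
        using pq(4) by (auto simp: D'_def)
      moreover have "F p = F q"
        using F_D pq by simp
      ultimately show ?thesis
        using pq by (intro exI[of _ p] exI[of _ q]) (auto simp: D'_def)
    qed
    moreover have "F c = z" "c \<in> D'"
      using F_D[of c] \<rho>(3) c D(2) by (auto simp: D'_def)
    ultimately show ?thesis
      by blast
  qed
  moreover have "interior D' = {}"
  proof (rule interior_emptyI)
    fix a b :: real assume ab: "a < b"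
    \<comment> \<open>A nonempty open set of reals is infinite, so it survives the removal of
      \<open>0\<close> and \<open>1\<close>.\<close>
    have "infinite ({a<..<b} - D)"
    proof
      assume fin: "finite ({a<..<b} - D)"
      have "open ({a<..<b} - D)"
        using D(1) by (intro open_Diff) auto
      then have "{a<..<b} - D = {}"
        using fin finite_imp_not_open by blast
      then show False
        using ex_notin_if_interior_empty[OF D(4) ab] by blast
    qed
    then have "\<not> {a<..<b} - D \<subseteq> {0,1}"
      using finite_subset by blast
    then show "\<exists>t\<in>{a<..<b}. t \<notin> D'"
      by (auto simp: D'_def)
  qed
  moreover have "D' \<subseteq> {0..1}"
    using D(3) by (auto simp: D'_def)
  moreover have "0 \<in> D'" "1 \<in> D'"
    by (auto simp: D'_def)
  ultimately show ?thesis
    using that[of D' F] \<open>closed D'\<close> \<open>continuous_on UNIV F\<close> \<open>F ` D' = K\<close> \<open>F 0 = x\<close> \<open>F 1 = y\<close>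
    by blast
qed

section \<open>Construction of the graph and the final theorem\<close>

lemma homeomorphic_map_pullback_topology:
  assumes "inj_on f A"
  shows "homeomorphic_map (pullback_topology A f T) (subtopology T (f ` A)) f"
proof (rule bijective_open_imp_homeomorphic_map)
  let ?P = "pullback_topology A f T"
  have "continuous_map ?P T f"
    using continuous_map_pullback[OF continuous_map_id, of A f T] by (simp add: id_def comp_def)
  then show "continuous_map ?P (subtopology T (f ` A)) f"
    by (rule continuous_map_into_subtopology) (auto simp: topspace_pullback_topology)
  show "open_map ?P (subtopology T (f ` A)) f"
    unfolding open_map_def
  proof (intro allI impI)
    fix S assume "openin ?P S"
    then obtain U where U: "openin T U" "S = f -` U \<inter> A"
      unfolding openin_pullback_topology by blast
    then have "f ` S = U \<inter> f ` A"
      by auto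
    with U show "openin (subtopology T (f ` A)) (f ` S)"
      unfolding openin_subtopology by blast
  qed
  show "f ` topspace ?P = topspace (subtopology T (f ` A))"
    by (auto simp: topspace_pullback_topology)
  show "inj_on f (topspace ?P)"
    using assms by (rule inj_on_subset) (auto simp: topspace_pullback_topology)
qed

text \<open>Let \<open>F\<close> be a continuous extension to \<open>[0,1]\<close> of a surjection of \<open>D\<close> onto the cube copy of \<open>Z\<close>, and let
  \<open>u\<close> be the distance to \<open>D\<close>.  The map \<open>t \<mapsto> (F t, u t, t u(t))\<close> glues \<open>[0,1]\<close> exactly along the fibres of \<open>F\<close>
  on \<open>D\<close>, since off \<open>D\<close> the parameter \<open>t\<close> is the quotient of the last two coordinates.  So its image
  is a metrizable model of the adjunction space.\<close>
lemma ex_open_eulerian_graph: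
  fixes Z :: "'a topology"
  assumes "compact_space Z" "metrizable_space Z" "x \<in> topspace Z" "y \<in> topspace Z"
  shows "\<exists>X :: ('a + nat \<times> real) topology.
    peano_graph X \<and> embedding_map Z X Inl \<and> Gr X = Inl ` topspace Z \<and> open_eulerian X (Inl x) (Inl y)"
proof -
  obtain i :: "'a \<Rightarrow> nat \<Rightarrow> real" where i: "continuous_map Z euclidean i" "inj_on i (topspace Z)"
    "\<And>z n. i z n \<in> {0..1}"
    using compact_metrizable_imp_cube_embedding[OF assms(1,2)] by blast
  define K where "K = i ` topspace Z"
  have "compact K"
    using image_compactin[of Z "topspace Z" euclidean i] i(1) assms(1)
    by (simp add: K_def compact_space_def)
  moreover have "K \<subseteq> UNIV \<rightarrow> {0..1}"
    using i(3) by (auto simp: K_def)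
  moreover have "i x \<in> K" "i y \<in> K"
    using assms(3,4) by (auto simp: K_def)
  ultimately obtain D :: "real set" and F :: "real \<Rightarrow> nat \<Rightarrow> real" where D: "closed D" "D \<subseteq> {0..1}" "0 \<in> D" "1 \<in> D"
      "interior D = {}"
    and F: "continuous_on UNIV F" "F ` D = K" "F 0 = i x" "F 1 = i y"
    and loops: "\<forall>z\<in>K. \<exists>c\<in>D. F c = z \<and> (\<forall>e>0. \<exists>p q. p < q \<and> p \<in> D \<and> q \<in> D
        \<and> {p<..<q} \<inter> D = {} \<and> F p = F q \<and> {p..q} \<subseteq> {c<..<c+e})"
    by (rule ground_curve)
  define h where "h t = (F t, infdist t D, t * infdist t D)" for t
  \<comment> \<open>Ground points are the points of \<open>Z\<close> themselves; an edge point is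
    its parameter off \<open>D\<close>, tagged with \<open>0\<close>.\<close>
  define A :: "('a + nat \<times> real) set" where "A = Inl ` topspace Z \<union> Inr ` ({0} \<times> ({0..1} - D))"
  define \<Psi> :: "'a + nat \<times> real \<Rightarrow> (nat \<Rightarrow> real) \<times> real \<times> real"
    where "\<Psi> v = (case v of Inl z \<Rightarrow> (i z, 0, 0) | Inr (n, t) \<Rightarrow> h t)" for v
  \<comment> \<open>Pulling back along the injection \<open>\<Psi>\<close> makes \<open>X\<close> a
    copy of a subspace of a metrizable product.\<close>
  define X where "X = pullback_topology A \<Psi> euclidean"
  define g :: "real \<Rightarrow> 'a + nat \<times> real"
    where "g t = (if t \<in> D then Inl (inv_into (topspace Z) i (F t)) else Inr (0, t))" for t
  have u_0: "infdist t D = 0 \<longleftrightarrow> t \<in> D" for t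
    using in_closed_iff_infdist_zero[OF D(1)] D(3) by blast
  have F_D: "F t \<in> i ` topspace Z" if "t \<in> D" for t
    using F(2) that by (auto simp: K_def)
  have topX: "topspace X = A"
    by (simp add: X_def topspace_pullback_topology)
  \<comment> \<open>On \<open>D\<close> the distance vanishes, so \<open>h t\<close> is
    \<open>(F t, 0, 0)\<close>, the image under \<open>\<Psi>\<close> of the ground point with cube
    coordinates \<open>F t\<close>.\<close>
  have \<Psi>_g: "\<Psi> (g t) = h t" for t
    using u_0[of t] F_D[of t] by (auto simp: \<Psi>_def g_def h_def f_inv_into_f)
  have g_A: "g t \<in> A" if "t \<in> {0..1}" for t
    using that inv_into_into[OF F_D[of t]] by (auto simp: g_def A_def)
  have "inj_on \<Psi> A"
  proof (rule inj_onI)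
    fix v w assume vw: "v \<in> A" "w \<in> A" "\<Psi> v = \<Psi> w"
    have h_inj: "s = t" if "h s = h t" "s \<notin> D" for s t
      using that u_0[of s] by (auto simp: h_def)
    have h_ne: "(k, 0, 0) \<noteq> h t" if "t \<notin> D" for k t
      using that u_0[of t] by (auto simp: h_def)
    have cases: "(\<exists>z\<in>topspace Z. v = Inl z) \<or> (\<exists>t. t \<notin> D \<and> v = Inr (0, t))" if "v \<in> A" for v
      using that by (auto simp: A_def)
    from cases[OF vw(1)] cases[OF vw(2)] show "v = w"
    proof (elim disjE bexE exE conjE)
      fix z z' assume "z \<in> topspace Z" "v = Inl z" "z' \<in> topspace Z" "w = Inl z'"
      then show ?thesis
        using vw(3) inj_onD[OF i(2)] by (simp add: \<Psi>_def)
    next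
      fix t z assume "t \<notin> D" "v = Inr (0, t)" "w = Inl z"
      then show ?thesis
        using vw(3) h_ne[of t "i z"] by (simp add: \<Psi>_def)
    next
      fix t z assume "t \<notin> D" "w = Inr (0, t)" "v = Inl z"
      then show ?thesis
        using vw(3) h_ne[of t "i z"] by (simp add: \<Psi>_def)
    next
      fix s t assume "s \<notin> D" "v = Inr (0, s)" "w = Inr (0, t)"
      then show ?thesis
        using vw(3) h_inj[of s t] by (simp add: \<Psi>_def)
    qed
  qed
  then have "homeomorphic_map X (top_of_set (\<Psi> ` A)) \<Psi>"
    unfolding X_def by (rule homeomorphic_map_pullback_topology)
  then have hom: "X homeomorphic_space top_of_set (\<Psi> ` A)"
    by (rule homeomorphic_map_imp_homeomorphic_space)
  have metr: "metrizable_space X"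
    using homeomorphic_metrizable_space[OF hom] metrizable_space_subtopology metrizable_space_euclidean by blast
  then have haus: "Hausdorff_space X"
    by (rule metrizable_imp_Hausdorff_space)
  have g_cont: "continuous_map (top_of_set {0..1}) X g"
    unfolding X_def
  proof (rule continuous_map_pullback')
    have "continuous_on {0..1} h"
      unfolding h_def by (intro continuous_intros continuous_on_subset[OF F(1)]) auto
    then show "continuous_map (top_of_set {0..1}) euclidean (\<Psi> \<circ> g)"
      by (simp add: comp_def \<Psi>_g)
  qed (use g_A in auto)
  have g_D: "g ` D = Inl ` topspace Z"
  proof -
    have "g ` D = Inl ` inv_into (topspace Z) i ` F ` D"
      unfolding image_image by (intro image_cong) (auto simp: g_def)
    also have "inv_into (topspace Z) i ` F ` D = topspace Z"
      unfolding F(2) K_def using i(2) by (rule inv_into_image_cancel) simp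
    finally show ?thesis .
  qed
  have g_surj: "g ` {0..1} = topspace X"
  proof -
    have "g ` {0..1} = g ` D \<union> g ` ({0..1} - D)"
      using D(2) by blast
    also have "g ` ({0..1} - D) = Inr ` ({0} \<times> ({0..1} - D))"
      by (auto simp: g_def image_iff)
    finally show ?thesis
      by (simp add: topX A_def g_D)
  qed
  interpret arc_quotient X g D
  proof
    fix s t :: real assume "s \<in> {0..1} - D" "t \<in> {0..1}" "g s = g t"
    then show "s = t"
      by (auto simp: g_def split: if_splits)
  next
    fix U z assume U: "openin X U" "z \<in> U" "z \<in> g ` D"
    then obtain s where s: "s \<in> D" "z = g s"
      by blast
    \<comment> \<open>Loops accumulate at a particular parameter \<open>c\<close> in the fibre of
      \<open>z\<close>, which may differ from \<open>s\<close>; since \<open>g c = z\<close>,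
      continuity at \<open>c\<close> suffices.\<close>
    then obtain c where c: "c \<in> D" "F c = F s" and c_loops: "\<And>e. e > 0 \<Longrightarrow> \<exists>p q. p < q \<and> p \<in> D \<and> q \<in> D
        \<and> {p<..<q} \<inter> D = {} \<and> F p = F q \<and> {p..q} \<subseteq> {c<..<c+e}"
      using bspec[OF loops, of "F s"] F(2) by blast
    have "g c = z"
      using s c by (simp add: g_def)
    have "openin (top_of_set {0..1}) {t \<in> {0..1}. g t \<in> U}"
      using openin_continuous_map_preimage[OF g_cont U(1)] by simp
    moreover have "c \<in> {t \<in> {0..1}. g t \<in> U}"
      using c(1) D(2) U(2) \<open>g c = z\<close> by auto
    ultimately obtain e where e: "e > 0" "ball c e \<inter> {0..1} \<subseteq> {t \<in> {0..1}. g t \<in> U}"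
      by (meson openin_contains_ball)
    obtain p q where pq: "p < q" "p \<in> D" "q \<in> D" "{p<..<q} \<inter> D = {}" "F p = F q" "{p..q} \<subseteq> {c<..<c+e}"
      using c_loops[OF e(1)] by blast
    have "t \<in> ball c e \<inter> {0..1}" if t: "t \<in> {p..q}" for t
    proof -
      have "t \<in> {c<..<c+e}"
        using t pq(6) by blast
      moreover have "0 \<le> p" "q \<le> 1"
        using pq(2,3) D(2) by auto
      ultimately show ?thesis
        using t by (auto simp: dist_real_def)
    qed
    then have "g ` {p..q} \<subseteq> U"
      using e(2) by blast
    moreover have "g p = g q"
      using pq by (simp add: g_def)
    ultimately show "\<exists>p q. p < q \<and> p \<in> D \<and> q \<in> D \<and> {p<..<q} \<inter> D = {} \<and> g p = g q \<and> g ` {p..q} \<subseteq> U"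
      using pq by blast
  qed (use haus g_cont g_surj D in auto)
  have "continuous_map Z X Inl"
    unfolding X_def
  proof (rule continuous_map_pullback')
    have "continuous_map Z (prod_topology euclidean (prod_topology euclidean euclidean)) (\<lambda>z. (i z, 0::real, 0::real))"
      by (intro continuous_map_pairedI i(1)) simp_all
    then show "continuous_map Z euclidean (\<Psi> \<circ> Inl)"
      by (simp add: comp_def \<Psi>_def)
  qed (auto simp: A_def)
  \<comment> \<open>A continuous injection of a compact space into a Hausdorff space is an
    embedding.\<close>
  then have "embedding_map Z X Inl"
    using continuous_imp_embedding_map[of Z X Inl] assms(1) haus by auto
  moreover have "g 0 = Inl x" "g 1 = Inl y"
    using D F i(2) assms(3,4) by (simp_all add: g_def)
  ultimately show ?thesis
    using peano_graph[OF metr] Gr_eq g_D open_eulerian by metis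
qed

theorem theorem2p4:
  fixes Z :: "'a topology"
  assumes "topspace Z \<noteq> {}" and "compact_space Z" and "metrizable_space Z"
  shows "(\<exists>X :: ('a + nat \<times> real) topology.
            peano_graph X \<and> embedding_map Z X Inl \<and> Gr X = Inl ` topspace Z)
       \<and> (\<exists>X :: ('a + nat \<times> real) topology.
            peano_graph X \<and> embedding_map Z X Inl \<and> Gr X = Inl ` topspace Z \<and> eulerian X)
       \<and> (\<forall>x\<in>topspace Z. \<forall>y\<in>topspace Z. \<exists>X :: ('a + nat \<times> real) topology.
            peano_graph X \<and> embedding_map Z X Inl \<and> Gr X = Inl ` topspace Z
            \<and> open_eulerian X (Inl x) (Inl y))"
proof -
  obtain x where "x \<in> topspace Z"
    using assms(1) by blast
  \<comment> \<open>The graph of a closed path based at \<open>x\<close> serves for both the first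
    and the second claim.\<close>
  then obtain X :: "('a + nat \<times> real) topology" where X: "peano_graph X" "embedding_map Z X Inl"
      "Gr X = Inl ` topspace Z" "open_eulerian X (Inl x) (Inl x)"
    using ex_open_eulerian_graph[OF assms(2,3)] by metis
  then have "eulerian X"
    by (intro open_eulerian_loop_imp_eulerian)
  show ?thesis
  proof (intro conjI ballI)
    show "\<exists>X :: ('a + nat \<times> real) topology.
        peano_graph X \<and> embedding_map Z X Inl \<and> Gr X = Inl ` topspace Z"
      using X by (intro exI[of _ X]) simp
    show "\<exists>X :: ('a + nat \<times> real) topology.
        peano_graph X \<and> embedding_map Z X Inl \<and> Gr X = Inl ` topspace Z \<and> eulerian X"
      using X \<open>eulerian X\<close> by (intro exI[of _ X]) simp
  qed (rule ex_open_eulerian_graph[OF assms(2,3)])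
qed

end
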